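(* Let $M\ge1$, $Z=\mathrm{diag}(z_1,\dots,z_M)$ with $z_a\in\mathbb{C}$, and let $v_i,\xi^a_i,\eta^a_i$ $(i\in\mathbb{Z},\ a=1,\dots,M)$ and the conventions for torus functions, $\star$, $\mathrm{tr}$ be as in the context. Let $$L(z,\vec\phi)=V(\phi_1)+\frac{i}{4\pi\hbar}\sum_{k=1}^{M}\frac{z_k\,\eta^k(\phi_2)\star\delta(\phi_1)\star\xi^k(-\phi_2)}{z-z_k},$$ i.e. the element with matrix modes $$L_{ij}(z)=v_i\delta_{ij}+\sum_{k=1}^{M}\frac{z_k\,\xi^k_i\eta^k_j}{z-z_k},\qquad i,j\in\mathbb{Z},$$ and let $$\tilde T(v)=Z\Big(I+\sum_{k=1}^{\infty}\frac{\tilde A^{[k-1]}}{v^{k}}\Big)\in \mathrm{Mat}_M[[v^{-1}]],\qquad \tilde A^{[k]}_{ab}=\sum_{i\in\mathbb{Z}}v_i^k\,\xi^a_i\eta^b_i .$$ Then, as formal power series in $v^{-1}$ whose coefficients are rational functions of $z$, $$\exp\Big(\mathrm{tr}\,\ln_\star\Big(I-\frac{V(\phi_1)}{v}\Big)\Big)\det\big(z-\tilde T(v)\big)=\det(z-Z)\,\exp\Big(\mathrm{tr}\,\ln_\star\Big(I-\frac1v L(z,\vec\phi)\Big)\Big).$$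
   Context: Data: $v_i\in\mathbb{C}$, $i\in\mathbb{Z}$, are pairwise distinct and rapidly decaying: for every $n$, $|v_k|^2(1+k^2)^n\to0$ as $|k|\to\infty$. The numbers $\xi^a_i,\eta^a_i\in\mathbb{C}$ ($a=1,\dots,M$, $i\in\mathbb{Z}$) are the Fourier modes of functions on the circle $\xi^a(\theta)=\sum_m\xi^a_me^{im\theta}$, $\eta^a(\theta)=\sum_m\eta^a_me^{im\theta}$, and their absolute values decay faster than $|v_i|^2$: $|\xi^a_i|/|v_i|^2\to0$, $|\eta^a_i|/|v_i|^2\to0$ as $|i|\to\infty$. Torus functions and matrix modes: the noncommutative torus algebra consists of functions $f(\vec\phi)=\sum_{\vec m\in\mathbb{Z}^2}f_{\vec m}e^{i\vec m\vec\phi}$ on the two-torus with the associative Moyal product $e^{i\vec m\vec\phi}\star e^{i\vec n\vec\phi}=\omega^{-\frac12(m_1n_2-n_1m_2)}e^{i(\vec m+\vec n)\vec\phi}$, $\omega=e^{4\pi i\hbar}$. An infinite matrix $(F_{ij})_{i,j\in\mathbb{Z}}$ is associated with the function with Fourier modes $F_{\vec m}=\frac{i}{4\pi\hbar}\,\omega^{m_1m_2/2}\sum_{i\in\mathbb{Z}}\omega^{m_1i}F_{i,i+m_2}$ (in the prefactor $i=\sqrt{-1}$; inside the sum $i$ is the summation index); the $F_{ij}$ are called the matrix modes. In particular $V(\phi_1)$ is the element with matrix modes $v_i\delta_{ij}$, and $\frac{i}{4\pi\hbar}\eta^k(\phi_2)\star\delta(\phi_1)\star\xi^k(-\phi_2)$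 is the element with matrix modes $\xi^k_i\eta^k_j$. For elements given by matrix modes, $\star$-products and traces are computed in matrix modes: $F\star G$ has matrix modes $\sum_{k\in\mathbb{Z}}F_{ik}G_{kj}$, and $\mathrm{tr}\,F=\sum_{i\in\mathbb{Z}}F_{ii}$. Logarithm: for such $F$ (with all traces convergent), $\mathrm{tr}\,\ln_\star\big(I-\frac1vF\big):=-\sum_{k=1}^{\infty}\frac{\mathrm{tr}\,F^{\star k}}{k\,v^k}$, a formal power series in $v^{-1}$ without constant term, and $\exp$ of it is the exponential of formal power series in $v^{-1}$. Here $F^{\star k}$ is the $k$-th $\star$-power, i.e. the $k$-th power of the infinite matrix of modes. *)

theory Defs
  imports "HOL-Analysis.Analysis" "HOL-Computational_Algebra.Formal_Power_Series"
begin

text \<open>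
  An element \<open>F\<close> of the noncommutative torus is represented by its infinite matrix \<open>(F i j)\<close> of matrix modes, and star products
  and traces are computed on the modes. The deformation parameter enters only through the
  passage from matrix modes to Fourier modes on the torus, so it does not appear here.

  Since \<open>infsum\<close> returns 0 on non-summable families, \<open>tr_ln_defined\<close> records separately
  that every series used in the definition of \<open>tr_ln\<close> converges.
\<close>

type_synonym modes = "int \<Rightarrow> int \<Rightarrow> complex"

definition star :: "modes \<Rightarrow> modes \<Rightarrow> modes" where
  "star F G = (\<lambda>i j. \<Sum>\<^sub>\<infinity>k. F i k * G k j)"

definition star_defined :: "modes \<Rightarrow> modes \<Rightarrow> bool" where
  "star_defined F G \<longleftrightarrow> (\<forall>i j. (\<lambda>k. F i k * G k j) summable_on UNIV)"

definition star_unit :: modes where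
  "star_unit = (\<lambda>i j. if i = j then 1 else 0)"

primrec star_power :: "modes \<Rightarrow> nat \<Rightarrow> modes" where
  "star_power F 0 = star_unit"
| "star_power F (Suc k) = star (star_power F k) F"

definition tr :: "modes \<Rightarrow> complex" where
  "tr F = (\<Sum>\<^sub>\<infinity>i. F i i)"

definition tr_defined :: "modes \<Rightarrow> bool" where
  "tr_defined F \<longleftrightarrow> (\<lambda>i. F i i) summable_on UNIV"

text \<open>
  \<open>tr_ln F\<close> is \<open>tr ln (I - F / v)\<close>; here and below the indeterminate \<open>fps_X\<close>
  of a formal power series stands for \<open>1 / v\<close>.
\<close>

definition tr_ln :: "modes \<Rightarrow> complex fps" where
  "tr_ln F = Abs_fps (\<lambda>k. if k = 0 then 0 else - tr (star_power F k) / of_nat k)"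

definition tr_ln_defined :: "modes \<Rightarrow> bool" where
  "tr_ln_defined F \<longleftrightarrow>
     (\<forall>k. star_defined (star_power F k) F \<and> tr_defined (star_power F (Suc k)))"

text \<open>\<open>fps_compose\<close> is the usual substitution only if the inner series has no constant term.\<close>

definition exp_fps :: "complex fps \<Rightarrow> complex fps" where
  "exp_fps f = fps_compose (fps_exp 1) f"

definition V_modes :: "(int \<Rightarrow> complex) \<Rightarrow> modes" where
  "V_modes v = (\<lambda>i j. if i = j then v i else 0)"

text \<open>
  Matrix modes of \<open>(i / (4 \<pi> hbar)) \<eta>(\<phi>\<^sub>2) \<star> \<delta>(\<phi>\<^sub>1) \<star> \<xi>(-\<phi>\<^sub>2)\<close>, where \<open>x\<close> and \<open>y\<close> are the
  sequences of Fourier modes of \<open>\<xi>\<close> and \<open>\<eta>\<close>.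
\<close>

definition rank_one_modes :: "(int \<Rightarrow> complex) \<Rightarrow> (int \<Rightarrow> complex) \<Rightarrow> modes" where
  "rank_one_modes x y = (\<lambda>i j. x i * y j)"

definition Lax ::
  "('m::finite \<Rightarrow> complex) \<Rightarrow> (int \<Rightarrow> complex) \<Rightarrow> ('m \<Rightarrow> int \<Rightarrow> complex) \<Rightarrow>
   ('m \<Rightarrow> int \<Rightarrow> complex) \<Rightarrow> complex \<Rightarrow> modes" where
  "Lax zs v \<xi> \<eta> z = (\<lambda>i j. V_modes v i j +
     (\<Sum>k\<in>UNIV. zs k * rank_one_modes (\<xi> k) (\<eta> k) i j / (z - zs k)))"

definition diag :: "('m::finite \<Rightarrow> 'a::zero) \<Rightarrow> 'a^'m^'m" where
  "diag d = (\<chi> a b. if a = b then d a else 0)"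

definition A_entry ::
  "(int \<Rightarrow> complex) \<Rightarrow> ('m \<Rightarrow> int \<Rightarrow> complex) \<Rightarrow> ('m \<Rightarrow> int \<Rightarrow> complex) \<Rightarrow>
   nat \<Rightarrow> 'm \<Rightarrow> 'm \<Rightarrow> complex" where
  "A_entry v \<xi> \<eta> k a b = (\<Sum>\<^sub>\<infinity>i. v i ^ k * \<xi> a i * \<eta> b i)"

text \<open>The ring of matrices over formal power series stands for power series with matrix
  coefficients.\<close>

definition T_matrix ::
  "('m::finite \<Rightarrow> complex) \<Rightarrow> (int \<Rightarrow> complex) \<Rightarrow> ('m \<Rightarrow> int \<Rightarrow> complex) \<Rightarrow>
   ('m \<Rightarrow> int \<Rightarrow> complex) \<Rightarrow> complex fps^'m^'m" where
  "T_matrix zs v \<xi> \<eta> =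
     diag (\<lambda>a. fps_const (zs a)) **
     (mat 1 + (\<chi> a b. Abs_fps (\<lambda>k. if k = 0 then 0 else A_entry v \<xi> \<eta> (k - 1) a b)))"

text \<open>On \<open>int\<close>, the filter \<open>cofinite\<close> expresses \<open>\<bar>k\<bar> \<rightarrow> \<infinity>\<close>.\<close>

definition rapidly_decaying :: "(int \<Rightarrow> complex) \<Rightarrow> bool" where
  "rapidly_decaying v \<longleftrightarrow>
     (\<forall>n::nat. ((\<lambda>k. (cmod (v k))\<^sup>2 * (1 + (real_of_int k)\<^sup>2) ^ n) \<longlongrightarrow> 0) cofinite)"

text \<open>
  An element of \<open>\<complex>(z)[[1/v]]\<close> whose coefficients have poles only in \<open>S\<close> is represented by
  the function sending \<open>z\<close> outside \<open>S\<close> to its value in \<open>\<complex>[[1/v]]\<close>. For finite \<open>S\<close>, two such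
  elements are equal iff these functions agree outside \<open>S\<close>.
\<close>

definition rational_coeffs_off :: "complex set \<Rightarrow> (complex \<Rightarrow> complex fps) \<Rightarrow> bool" where
  "rational_coeffs_off S f \<longleftrightarrow>
     (\<forall>n. \<exists>p q :: complex poly. \<forall>z. z \<notin> S \<longrightarrow>
        poly q z \<noteq> 0 \<and> fps_nth (f z) n = poly p z / poly q z)"

end

theory Submission imports Defs begin

text \<open>
  Put \<open>x = 1/v\<close> and \<open>c\<^sub>k = z\<^sub>k/(z - z\<^sub>k)\<close>, so that \<open>L = V + \<xi> C \<eta>\<close> with \<open>C = diag c\<close> is a finite-rank perturbation
  of the diagonal matrix \<open>V\<close>. The Woodbury formula gives the resolvent
  \<open>(1 - x L)\<^sup>-\<^sup>1 = G + x G \<xi> W \<eta> G\<close>, where \<open>G = (1 - x V)\<^sup>-\<^sup>1\<close>, \<open>W = C (1 - x P C)\<^sup>-\<^sup>1\<close> and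
  \<open>P = \<eta> G \<xi>\<close> is the transpose of \<open>\<Sum>\<^sub>k x\<^sup>k A\<^sup>[\<^sup>k\<^sup>]\<close>. Its coefficients are the powers of \<open>L\<close>. Since
  \<open>\<eta> G\<^sup>2 \<xi> = (x P)'\<close>, taking traces gives \<open>(tr ln (1 - x L) - tr ln (1 - x V))' = - tr (W (x P)')\<close>, which by
  Jacobi's formula is the logarithmic derivative of \<open>det (1 - x P C)\<close>. Hence
  \<open>exp (tr ln (1 - x V)) det (1 - x P C)\<close> and \<open>exp (tr ln (1 - x L))\<close> solve the same linear differential
  equation in \<open>x\<close> with the same constant term. Finally \<open>z - T\<close> is \<open>z - Z\<close> times the transpose of
  \<open>1 - x P C\<close>.
\<close>

subsection \<open>Determinants over formal power series\<close>

lemma fps_deriv_prod: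
  fixes f :: "'i \<Rightarrow> 'a::comm_ring_1 fps"
  assumes "finite S"
  shows "fps_deriv (\<Prod>i\<in>S. f i) = (\<Sum>i\<in>S. fps_deriv (f i) * (\<Prod>j\<in>S - {i}. f j))"
  using assms
proof (induction S)
  case (insert x S)
  have "(\<Prod>j\<in>insert x S - {i}. f j) = f x * (\<Prod>j\<in>S - {i}. f j)" if "i \<in> S" for i
  proof -
    have "insert x S - {i} = insert x (S - {i})" using insert that by auto
    then show ?thesis using insert by simp
  qed
  moreover have "insert x S - {x} = S" using insert by auto
  ultimately show ?case
    using insert by (simp add: sum_distrib_left algebra_simps)
qed simp

text \<open>The product rule applies to each permutation term; exchanging the two sums collects the
  terms in which row \<open>i\<close> is differentiated.\<close>

lemma fps_deriv_det:
  fixes M :: "'a::comm_ring_1 fps^'n^'n"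
  shows "fps_deriv (det M) =
    (\<Sum>i\<in>UNIV. det (\<chi> k. if k = i then (\<chi> j. fps_deriv (M $ i $ j)) else M $ k))"
proof -
  have row: "(\<Prod>k\<in>UNIV. (if k = i then (\<chi> j. fps_deriv (M $ i $ j)) else M $ k) $ p k) =
      fps_deriv (M $ i $ p i) * (\<Prod>k\<in>UNIV - {i}. M $ k $ p k)" for i :: 'n and p
  proof -
    have "(\<Prod>k\<in>UNIV. (if k = i then (\<chi> j. fps_deriv (M $ i $ j)) else M $ k) $ p k) =
      fps_deriv (M $ i $ p i) *
      (\<Prod>k\<in>UNIV - {i}. (if k = i then (\<chi> j. fps_deriv (M $ i $ j)) else M $ k) $ p k)"
      by (subst prod.remove[of _ i]) auto
    also have "(\<Prod>k\<in>UNIV - {i}. (if k = i then (\<chi> j. fps_deriv (M $ i $ j)) else M $ k) $ p k) =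
      (\<Prod>k\<in>UNIV - {i}. M $ k $ p k)"
      by (rule prod.cong) auto
    finally show ?thesis .
  qed
  have of_int: "fps_deriv (of_int n * f) = of_int n * fps_deriv f" for n and f :: "'a fps"
    by (simp add: fps_of_int [symmetric])
  show ?thesis
    unfolding det_def vec_lambda_beta row
    by (subst sum.swap) (simp add: fps_deriv_sum of_int fps_deriv_prod sum_distrib_left)
qed

lemma fps_nth_0_det:
  fixes M :: "'a::comm_ring_1 fps^'n^'n"
  shows "fps_nth (det M) 0 = det (\<chi> i j. fps_nth (M $ i $ j) 0)"
proof -
  have "fps_nth (of_int n :: 'a fps) 0 = of_int n" for n
    by (simp add: fps_of_int [symmetric])
  moreover have "fps_nth (\<Prod>i\<in>S. f i) 0 = (\<Prod>i\<in>S. fps_nth (f i) 0)"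
    for S :: "'n set" and f :: "'n \<Rightarrow> 'a fps"
    by (induction S rule: infinite_finite_induct) auto
  ultimately show ?thesis
    by (simp add: det_def fps_sum_nth)
qed

text \<open>For \<open>i \<noteq> j\<close> the modified matrix has equal rows \<open>i\<close> and
  \<open>j\<close>.\<close>

lemma det_replace_row:
  fixes M :: "'a::comm_ring_1^'n^'n"
  shows "det (\<chi> k. if k = i then M $ j else M $ k) = (if i = j then det M else 0)"
proof (cases "i = j")
  case True
  then have "(\<chi> k. if k = i then M $ j else M $ k) = M" by (simp add: vec_eq_iff)
  with True show ?thesis by simp
next
  case False
  then show ?thesis
    by (auto intro!: det_identical_rows[of i j] simp: row_def vec_eq_iff)
qed

lemma det_replace_row_sum:
  fixes M :: "'a::comm_ring_1^'n^'n" and r :: "'j::finite \<Rightarrow> 'a^'n"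
  shows "det (\<chi> k. if k = i then (\<Sum>j\<in>UNIV. c j *s r j) else M $ k) =
    (\<Sum>j\<in>UNIV. c j * det (\<chi> k. if k = i then r j else M $ k))"
  using det_linear_row_sum[of UNIV i "\<lambda>_ j. c j *s r j" "\<lambda>k. M $ k"]
  by (simp add: det_row_mul[of i _ "\<lambda>_. r _"])

text \<open>Jacobi's formula. As \<open>M' = K ** M\<close> with \<open>K = M' ** N\<close>, each
  row of \<open>M'\<close> is a combination of rows of \<open>M\<close>; putting it in place of row
  \<open>i\<close> of \<open>M\<close> leaves only the coefficient \<open>K $ i $ i\<close>.\<close>

lemma fps_deriv_det_left_inverse:
  fixes M N :: "'a::comm_ring_1 fps^'n^'n"
  assumes "N ** M = mat 1"
  shows "fps_deriv (det M) = trace ((\<chi> i j. fps_deriv (M $ i $ j)) ** N) * det M"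
proof -
  define M' where "M' = (\<chi> i j. fps_deriv (M $ i $ j))"
  define K where "K = M' ** N"
  have "K ** M = M'"
    unfolding K_def by (simp add: assms flip: matrix_mul_assoc)
  then have "(\<chi> j. fps_deriv (M $ i $ j)) = (\<Sum>j\<in>UNIV. K $ i $ j *s M $ j)" for i
    by (auto simp: M'_def matrix_matrix_mult_def vec_eq_iff sum_component)
  then have "fps_deriv (det M) = (\<Sum>i\<in>UNIV. \<Sum>j\<in>UNIV. K $ i $ j * (if i = j then det M else 0))"
    unfolding fps_deriv_det by (simp only: det_replace_row_sum det_replace_row)
  also have "\<dots> = trace K * det M"
    by (simp add: trace_def if_distrib sum_distrib_right cong: if_cong)
  finally show ?thesis unfolding K_def M'_def .
qed

lemma exists_adjugate:
  fixes M :: "'a::comm_ring_1^'n^'n"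
  shows "\<exists>N. N ** M = mat (det M)"
proof -
  define Mt where "Mt = transpose M"
  \<comment> \<open>Cramer's rule: the entries are cofactors, written as determinants of the
    transpose with one row replaced by a unit vector.\<close>
  define N :: "'a^'n^'n" where "N = (\<chi> a b. det (\<chi> k. if k = a then axis b 1 else Mt $ k))"
  have "(\<Sum>b\<in>UNIV. N $ a $ b * M $ b $ c) = (if a = c then det M else 0)" for a c
  proof -
    have "(\<Sum>b\<in>UNIV. N $ a $ b * M $ b $ c) =
        det (\<chi> k. if k = a then (\<Sum>b\<in>UNIV. M $ b $ c *s axis b 1) else Mt $ k)"
      by (simp add: det_replace_row_sum N_def mult.commute)
    also have "(\<Sum>b\<in>UNIV. M $ b $ c *s axis b 1) = Mt $ c"
      by (simp add: vec_eq_iff Mt_def transpose_def sum_component axis_def if_distrib cong: if_cong)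
    finally show ?thesis by (simp add: det_replace_row Mt_def)
  qed
  then have "N ** M = mat (det M)"
    by (simp add: matrix_matrix_mult_def mat_def vec_eq_iff)
  then show ?thesis ..
qed

text \<open>A nonzero constant term makes the determinant a unit among power series, so the adjugate
  can be divided by it.\<close>

lemma fps_matrix_left_invertible:
  fixes M :: "'a::field fps^'n^'n"
  assumes "fps_nth (det M) 0 \<noteq> 0"
  shows "\<exists>N. N ** M = mat 1"
proof -
  obtain N where N: "N ** M = mat (det M)" using exists_adjugate by blast
  have *: "(\<Sum>k\<in>UNIV. N $ a $ k * M $ k $ b) = (if a = b then det M else 0)" for a b
    using N by (simp add: matrix_matrix_mult_def mat_def vec_eq_iff)
  have "(\<chi> a b. inverse (det M) * N $ a $ b) ** M = mat 1"
    using inverse_mult_eq_1[OF assms]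
    by (auto simp: matrix_matrix_mult_def mat_def vec_eq_iff mult.assoc * simp flip: sum_distrib_left)
  then show ?thesis ..
qed

section \<open>Linear differential equations and exponentials of power series\<close>

text \<open>Coefficient \<open>n + 1\<close> of a solution is fixed by the lower ones, since
  characteristic zero permits division by \<open>n + 1\<close>.\<close>

lemma fps_ode_unique:
  fixes Y Z G :: "'a::field_char_0 fps"
  assumes "fps_deriv Y = Y * G" "fps_deriv Z = Z * G" "fps_nth Y 0 = fps_nth Z 0"
  shows "Y = Z"
proof (rule fps_ext)
  fix n
  show "fps_nth Y n = fps_nth Z n"
  proof (induction n rule: less_induct)
    case (less n)
    show ?case
    proof (cases n)
      case (Suc m)
      have "fps_nth (fps_deriv Y) m = fps_nth (fps_deriv Z) m"
        unfolding assms(1,2) fps_mult_nth using less Suc by (intro sum.cong) auto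
      then have "of_nat (m + 1) * fps_nth Y (m + 1) = of_nat (m + 1) * fps_nth Z (m + 1)"
        by (simp only: fps_deriv_nth)
      then show ?thesis using Suc
        by (metis Suc_eq_plus1 mult_cancel_left of_nat_eq_0_iff nat.distinct(1))
    qed (simp add: assms)
  qed
qed

lemma fps_deriv_exp_fps:
  assumes "fps_nth f 0 = 0"
  shows "fps_deriv (exp_fps f) = exp_fps f * fps_deriv f"
  unfolding exp_fps_def using fps_compose_deriv[OF assms, of "fps_exp 1"]
  by simp

lemma exp_fps_nth_0: "fps_nth (exp_fps f) 0 = 1"
  by (simp add: exp_fps_def)

text \<open>Differentiation cancels the factor \<open>1 / k\<close> and shifts the index by one,
  leaving the generating series of the traces of powers.\<close>

lemma fps_deriv_tr_ln_nth: "fps_nth (fps_deriv (tr_ln F)) n = - tr (star_power F (Suc n))"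
  by (simp add: tr_ln_def del: star_power.simps of_nat_Suc flip: Suc_eq_plus1)

subsection \<open>Finite-rank perturbations of a diagonal matrix\<close>

text \<open>Coefficientwise convergence in \<open>\<complex>\<close>; the library's topology on power series is the \<open>fps_X\<close>-adic one,
  in which the sums below diverge.\<close>

definition has_coeff_sum :: "('i \<Rightarrow> complex fps) \<Rightarrow> complex fps \<Rightarrow> bool" where
  "has_coeff_sum f S \<longleftrightarrow> (\<forall>n. ((\<lambda>i. fps_nth (f i) n) has_sum fps_nth S n) UNIV)"

lemma has_coeff_sum_add:
  "has_coeff_sum f S \<Longrightarrow> has_coeff_sum g T \<Longrightarrow> has_coeff_sum (\<lambda>i. f i + g i) (S + T)"
  by (auto simp: has_coeff_sum_def intro!: has_sum_add)

lemma has_sum_finite_sum: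
  fixes f :: "'k \<Rightarrow> 'i \<Rightarrow> 'a::topological_comm_monoid_add"
  assumes "\<And>k. k \<in> K \<Longrightarrow> (f k has_sum S k) A"
  shows "((\<lambda>i. \<Sum>k\<in>K. f k i) has_sum (\<Sum>k\<in>K. S k)) A"
  using assms by (induction K rule: infinite_finite_induct) (auto intro: has_sum_add)

lemma has_coeff_sum_sum:
  "(\<And>k. k \<in> K \<Longrightarrow> has_coeff_sum (f k) (S k)) \<Longrightarrow>
    has_coeff_sum (\<lambda>i. \<Sum>k\<in>K. f k i) (\<Sum>k\<in>K. S k)"
  by (auto simp: has_coeff_sum_def fps_sum_nth intro!: has_sum_finite_sum)

lemma has_coeff_sum_mult:
  "has_coeff_sum f S \<Longrightarrow> has_coeff_sum (\<lambda>i. c * f i) (c * S)"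
  by (auto simp: has_coeff_sum_def fps_mult_nth intro!: has_sum_finite_sum has_sum_cmult_right)

lemma has_coeff_sum_single: "has_coeff_sum (\<lambda>i. if i = j then f i else 0) (f j)"
  unfolding has_coeff_sum_def by (auto intro!: has_sum_finite_neutralI[of "{j}"] split: if_splits)

text \<open>The expansion of \<open>1 / (1 - a * fps_X)\<close>; with \<open>a = v i\<close> it is a
  diagonal entry of \<open>G\<close>.\<close>

definition geometric_fps :: "complex \<Rightarrow> complex fps" where
  "geometric_fps a = Abs_fps (\<lambda>n. a ^ n)"

lemma geometric_fps_eq: "fps_X * (fps_const a * geometric_fps a) = geometric_fps a - 1"
proof (rule fps_ext)
  fix n show "fps_nth (fps_X * (fps_const a * geometric_fps a)) n = fps_nth (geometric_fps a - 1) n"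
    by (cases n) (simp_all add: geometric_fps_def)
qed

lemma geometric_fps_squared_nth:
  "fps_nth (geometric_fps a * geometric_fps a) n = of_nat (Suc n) * a ^ n"
  by (simp add: geometric_fps_def fps_mult_nth flip: power_add)

text \<open>The decay conditions enter only through these convergent series. The exponent
  \<open>Suc n\<close> excludes the divergent sum of ones. Keeping \<open>c\<close> arbitrary lets
  \<open>c = 0\<close> recover \<open>V\<close>.\<close>

locale finite_rank_perturbation =
  fixes v :: "int \<Rightarrow> complex" and \<xi> \<eta> :: "'m::finite \<Rightarrow> int \<Rightarrow> complex" and c :: "'m \<Rightarrow> complex"
  assumes summable_powers: "\<And>n. (\<lambda>i. v i ^ Suc n) summable_on UNIV"
    and summable_moments: "\<And>k a b. (\<lambda>i. v i ^ k * \<xi> a i * \<eta> b i) summable_on UNIV"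
begin

definition L :: modes where
  "L i j = V_modes v i j + (\<Sum>k\<in>UNIV. c k * rank_one_modes (\<xi> k) (\<eta> k) i j)"

abbreviation g :: "int \<Rightarrow> complex fps" where "g i \<equiv> geometric_fps (v i)"

definition A :: "'m \<Rightarrow> 'm \<Rightarrow> complex fps" where
  "A a b = Abs_fps (\<lambda>n. A_entry v \<xi> \<eta> n a b)"

text \<open>The matrix \<open>1 - x P C\<close>; the indices of \<open>A\<close> are swapped because
  \<open>P\<close> is its transpose.\<close>

definition M :: "complex fps^'m^'m" where
  "M = (\<chi> a b. (if a = b then 1 else 0) - fps_X * A b a * fps_const (c b))"

definition N :: "complex fps^'m^'m" where
  "N = (SOME N. N ** M = mat 1)"

definition W :: "'m \<Rightarrow> 'm \<Rightarrow> complex fps" where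
  "W a b = fps_const (c a) * N $ a $ b"

text \<open>The \<open>(i, j)\<close> entry of the resolvent \<open>(1 - fps_X * L)\<^sup>-\<^sup>1\<close>, as given by the Woodbury formula for
  the diagonal matrix \<open>V\<close> perturbed by \<open>L - V\<close>.\<close>

definition R :: "int \<Rightarrow> int \<Rightarrow> complex fps" where
  "R i j = (if i = j then g i else 0) +
     fps_X * (\<Sum>a\<in>UNIV. \<Sum>b\<in>UNIV. fps_const (\<xi> a i * \<eta> b j) * (g i * g j * W a b))"

lemma det_M_nth_0: "fps_nth (det M) 0 = 1"
proof -
  have "(\<chi> i j. fps_nth (M $ i $ j) 0) = mat 1"
    by (simp add: M_def mat_def vec_eq_iff)
  then show ?thesis by (simp add: fps_nth_0_det)
qed

lemma N_M: "N ** M = mat 1"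
  unfolding N_def by (rule someI_ex) (simp add: fps_matrix_left_invertible det_M_nth_0)

text \<open>This is \<open>x W P C = W - C\<close>, obtained from \<open>N (1 - x P C) = 1\<close>
  by multiplying with \<open>C\<close> on the left.\<close>

lemma W_eq:
  "fps_X * (\<Sum>d\<in>UNIV. W a d * A b d) * fps_const (c b) = W a b - (if a = b then fps_const (c a) else 0)"
proof -
  have "(N ** M) $ a $ b = mat 1 $ a $ b" by (simp add: N_M)
  moreover have "N $ a $ d * M $ d $ b =
      (if d = b then N $ a $ d else 0) - N $ a $ d * (fps_X * A b d * fps_const (c b))" for d
    by (simp add: M_def algebra_simps)
  ultimately have "N $ a $ b - (\<Sum>d\<in>UNIV. N $ a $ d * (fps_X * A b d * fps_const (c b))) =
      (if a = b then 1 else 0)"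
    by (simp add: matrix_matrix_mult_def mat_def sum_subtractf)
  then have "fps_const (c a) * (\<Sum>d\<in>UNIV. N $ a $ d * (fps_X * A b d * fps_const (c b))) =
      W a b - (if a = b then fps_const (c a) else 0)"
    by (auto simp: W_def algebra_simps split: if_splits)
  then show ?thesis
    by (simp add: W_def sum_distrib_left sum_distrib_right mult_ac)
qed

lemma has_coeff_sum_A:
  "has_coeff_sum (\<lambda>i. fps_const (\<xi> a i * \<eta> b i) * g i) (A a b)"
  unfolding has_coeff_sum_def
proof
  fix n
  show "((\<lambda>i. fps_nth (fps_const (\<xi> a i * \<eta> b i) * g i) n) has_sum fps_nth (A a b) n) UNIV"
    using has_sum_infsum[OF summable_moments[of n a b]]
    by (simp add: A_def A_entry_def geometric_fps_def mult_ac)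
qed

text \<open>The identity \<open>\<eta> G\<^sup>2 \<xi> = (x P)'\<close>: coefficient
  \<open>n\<close> carries the factor \<open>n + 1\<close> on both sides, once from squaring the
  geometric series and once from differentiation.\<close>

lemma has_coeff_sum_deriv_A:
  "has_coeff_sum (\<lambda>i. fps_const (\<xi> a i * \<eta> b i) * (g i * g i)) (fps_deriv (fps_X * A a b))"
  unfolding has_coeff_sum_def
proof
  fix n
  show "((\<lambda>i. fps_nth (fps_const (\<xi> a i * \<eta> b i) * (g i * g i)) n)
      has_sum fps_nth (fps_deriv (fps_X * A a b)) n) UNIV"
    using has_sum_cmult_right[OF has_sum_infsum[OF summable_moments[of n a b]], of "of_nat (Suc n)"]
    unfolding fps_mult_left_const_nth geometric_fps_squared_nth
    by (simp add: A_def A_entry_def mult_ac del: fps_deriv_mult of_nat_Suc)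
qed

text \<open>The resolvent equation \<open>R = 1 + x R L\<close>. Entries of \<open>R L\<close> are
  infinite sums, so \<open>S\<close> carries convergence and value together.\<close>

lemma R_L:
  obtains S where "has_coeff_sum (\<lambda>k. R i k * fps_const (L k j)) S"
    and "R i j = (if i = j then 1 else 0) + fps_X * S"
proof
  \<comment> \<open>\<open>T b\<close> is entry \<open>(b, j)\<close> of \<open>\<eta> G L\<close>,
    and \<open>S\<close> is entry \<open>(i, j)\<close> of \<open>R L\<close>. Expanding
    \<open>L = V + \<xi> C \<eta>\<close> turns the sums over \<open>k\<close> into entries of
    \<open>A\<close>.\<close>
  define T where "T b = fps_const (\<eta> b j) * (fps_const (v j) * g j) +
    (\<Sum>d\<in>UNIV. fps_const (c d * \<eta> d j) * A d b)" for b
  define S where "S = fps_const (L i j) * g i +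
    (\<Sum>a\<in>UNIV. \<Sum>b\<in>UNIV. (fps_X * fps_const (\<xi> a i) * g i * W a b) * T b)"
  have T: "has_coeff_sum (\<lambda>k. fps_const (\<eta> b k) * g k * fps_const (L k j)) (T b)" for b
  proof -
    have "(\<lambda>k. fps_const (\<eta> b k) * g k * fps_const (L k j)) =
      (\<lambda>k. (if k = j then fps_const (\<eta> b k) * (fps_const (v k) * g k) else 0) +
        (\<Sum>d\<in>UNIV. fps_const (c d * \<eta> d j) * (fps_const (\<xi> d k * \<eta> b k) * g k)))"
    proof
      fix k
      have "fps_const (L k j) = (if k = j then fps_const (v k) else 0) +
        (\<Sum>d\<in>UNIV. fps_const (c d) * fps_const (\<xi> d k) * fps_const (\<eta> d j))"
        by (rule fps_ext) (simp add: L_def V_modes_def rank_one_modes_def fps_sum_nth mult_ac)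
      then show "fps_const (\<eta> b k) * g k * fps_const (L k j) =
        (if k = j then fps_const (\<eta> b k) * (fps_const (v k) * g k) else 0) +
        (\<Sum>d\<in>UNIV. fps_const (c d * \<eta> d j) * (fps_const (\<xi> d k * \<eta> b k) * g k))"
        by (simp add: distrib_left sum_distrib_left mult_ac flip: fps_const_mult)
    qed
    then show ?thesis
      unfolding T_def
      by (simp only:) (intro has_coeff_sum_add has_coeff_sum_single has_coeff_sum_sum
          has_coeff_sum_mult has_coeff_sum_A)
  qed
  have "(\<lambda>k. R i k * fps_const (L k j)) = (\<lambda>k. (if k = i then fps_const (L k j) * g k else 0) +
    (\<Sum>a\<in>UNIV. \<Sum>b\<in>UNIV. (fps_X * fps_const (\<xi> a i) * g i * W a b) *
      (fps_const (\<eta> b k) * g k * fps_const (L k j))))"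
    by (intro ext) (auto simp: R_def distrib_right distrib_left sum_distrib_left
        sum_distrib_right mult_ac simp flip: fps_const_mult)
  then show "has_coeff_sum (\<lambda>k. R i k * fps_const (L k j)) S"
    unfolding S_def
    by (simp only:) (intro has_coeff_sum_add has_coeff_sum_single has_coeff_sum_sum
        has_coeff_sum_mult T)
  \<comment> \<open>In matrix form \<open>x W \<eta> G L = W \<eta> G - C \<eta>\<close>: the part
    from \<open>V\<close> gives \<open>W \<eta> (G - 1)\<close>, the finite-rank part gives
    \<open>(W - C) \<eta>\<close> by \<open>W_eq\<close>.\<close>
  have XT: "fps_X * (\<Sum>b\<in>UNIV. W a b * T b) =
      (\<Sum>b\<in>UNIV. fps_const (\<eta> b j) * g j * W a b) - fps_const (c a * \<eta> a j)" for a
  proof -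
    have "fps_X * (\<Sum>b\<in>UNIV. W a b * T b) =
      (\<Sum>b\<in>UNIV. fps_const (\<eta> b j) * W a b * (fps_X * (fps_const (v j) * g j))) +
      (\<Sum>b\<in>UNIV. \<Sum>d\<in>UNIV. fps_X * (W a b * A d b) * fps_const (c d) * fps_const (\<eta> d j))"
      by (simp add: T_def distrib_left sum.distrib sum_distrib_left mult_ac flip: fps_const_mult)
    also have "(\<Sum>b\<in>UNIV. \<Sum>d\<in>UNIV. fps_X * (W a b * A d b) * fps_const (c d) * fps_const (\<eta> d j)) =
      (\<Sum>d\<in>UNIV. (fps_X * (\<Sum>b\<in>UNIV. W a b * A d b) * fps_const (c d)) * fps_const (\<eta> d j))"
      by (subst sum.swap) (simp add: sum_distrib_left sum_distrib_right)
    also have "\<dots> = (\<Sum>d\<in>UNIV. W a d * fps_const (\<eta> d j)) - fps_const (c a * \<eta> a j)"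
    proof -
      have "(W a d - (if a = d then fps_const (c a) else 0)) * fps_const (\<eta> d j) =
        W a d * fps_const (\<eta> d j) - (if a = d then fps_const (c a * \<eta> a j) else 0)" for d
        by (simp add: left_diff_distrib)
      then show ?thesis unfolding W_eq by (simp add: sum_subtractf)
    qed
    finally show ?thesis
      unfolding geometric_fps_eq by (simp add: algebra_simps sum_subtractf)
  qed
  have "fps_X * (\<Sum>a\<in>UNIV. \<Sum>b\<in>UNIV. (fps_X * fps_const (\<xi> a i) * g i * W a b) * T b) =
    (\<Sum>a\<in>UNIV. fps_X * fps_const (\<xi> a i) * g i * (fps_X * (\<Sum>b\<in>UNIV. W a b * T b)))"
    by (simp add: sum_distrib_left mult_ac)
  also have "\<dots> = (\<Sum>a\<in>UNIV. fps_X * fps_const (\<xi> a i) * g i *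
      (\<Sum>b\<in>UNIV. fps_const (\<eta> b j) * g j * W a b)) -
    (\<Sum>a\<in>UNIV. fps_X * fps_const (\<xi> a i) * g i * fps_const (c a * \<eta> a j))"
    unfolding XT by (simp add: right_diff_distrib sum_subtractf)
  finally have *: "fps_X * (\<Sum>a\<in>UNIV. \<Sum>b\<in>UNIV. (fps_X * fps_const (\<xi> a i) * g i * W a b) * T b) =
    \<dots>" .
  \<comment> \<open>This yields \<open>x G L = (G - 1) + x G \<xi> C \<eta>\<close>, whose last term
    cancels the one subtracted in \<open>XT\<close>.\<close>
  have "fps_const (L i j) = (if i = j then fps_const (v i) else 0) +
        (\<Sum>d\<in>UNIV. fps_const (\<xi> d i) * fps_const (c d * \<eta> d j))"
    by (rule fps_ext) (simp add: L_def V_modes_def rank_one_modes_def fps_sum_nth mult_ac)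
  then have "fps_X * (fps_const (L i j) * g i) =
    (if i = j then fps_X * (fps_const (v i) * g i) else 0) +
    (\<Sum>a\<in>UNIV. fps_X * fps_const (\<xi> a i) * g i * fps_const (c a * \<eta> a j))"
    by (simp add: distrib_left distrib_right sum_distrib_left sum_distrib_right mult_ac)
  then have "fps_X * S = (if i = j then g i - 1 else 0) +
    (\<Sum>a\<in>UNIV. fps_X * fps_const (\<xi> a i) * g i * (\<Sum>b\<in>UNIV. fps_const (\<eta> b j) * g j * W a b))"
    unfolding S_def distrib_left * geometric_fps_eq by simp
  then show "R i j = (if i = j then 1 else 0) + fps_X * S"
    by (simp add: R_def sum_distrib_left mult_ac flip: fps_const_mult)
qed

lemma R_nth_0: "fps_nth (R i j) 0 = star_unit i j"
  by (simp add: R_def geometric_fps_def star_unit_def)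

lemma R_nth_Suc: "((\<lambda>k. fps_nth (R i k) n * L k j) has_sum fps_nth (R i j) (Suc n)) UNIV"
proof -
  obtain S where "has_coeff_sum (\<lambda>k. R i k * fps_const (L k j)) S"
    and "R i j = (if i = j then 1 else 0) + fps_X * S" by (rule R_L)
  moreover from this have "fps_nth (R i j) (Suc n) = fps_nth S n" by simp
  ultimately show ?thesis by (simp add: has_coeff_sum_def)
qed

text \<open>By \<open>R_nth_Suc\<close> the coefficients of \<open>R\<close> obey the recursion of
  the powers of \<open>L\<close>, and they start at the unit.\<close>

lemma star_power_L: "star_power L n i j = fps_nth (R i j) n"
proof (induction n arbitrary: i j)
  case (Suc n)
  then show ?case
    using infsumI[OF R_nth_Suc] by (simp add: star_def)
qed (simp add: R_nth_0)

text \<open>Beyond \<open>g i\<close>, the entry \<open>R i i\<close> is \<open>fps_X\<close> times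
  terms in \<open>g i * g i\<close>. That factor lowers the index from \<open>Suc n\<close> to
  \<open>n\<close>, and summation over \<open>i\<close> produces \<open>(x A)'\<close>.\<close>

lemma trace_has_sum:
  "((\<lambda>i. star_power L (Suc n) i i) has_sum
    ((\<Sum>\<^sub>\<infinity>i. v i ^ Suc n) +
     fps_nth (\<Sum>a\<in>UNIV. \<Sum>b\<in>UNIV. W a b * fps_deriv (fps_X * A a b)) n)) UNIV"
proof -
  have "has_coeff_sum
      (\<lambda>i. \<Sum>a\<in>UNIV. \<Sum>b\<in>UNIV. W a b * (fps_const (\<xi> a i * \<eta> b i) * (g i * g i)))
      (\<Sum>a\<in>UNIV. \<Sum>b\<in>UNIV. W a b * fps_deriv (fps_X * A a b))"
    by (intro has_coeff_sum_sum has_coeff_sum_mult has_coeff_sum_deriv_A)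
  then have "((\<lambda>i. v i ^ Suc n +
      fps_nth (\<Sum>a\<in>UNIV. \<Sum>b\<in>UNIV. W a b * (fps_const (\<xi> a i * \<eta> b i) * (g i * g i))) n) has_sum
      ((\<Sum>\<^sub>\<infinity>i. v i ^ Suc n) +
       fps_nth (\<Sum>a\<in>UNIV. \<Sum>b\<in>UNIV. W a b * fps_deriv (fps_X * A a b)) n)) UNIV"
    unfolding has_coeff_sum_def by (intro has_sum_add has_sum_infsum summable_powers) blast
  moreover have "star_power L (Suc n) i i = v i ^ Suc n +
      fps_nth (\<Sum>a\<in>UNIV. \<Sum>b\<in>UNIV. W a b * (fps_const (\<xi> a i * \<eta> b i) * (g i * g i))) n" for i
    unfolding star_power_L R_def by (simp add: geometric_fps_def mult_ac)
  ultimately show ?thesis by simp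
qed

lemma tr_ln_defined_L: "tr_ln_defined L"
  unfolding tr_ln_defined_def star_defined_def tr_defined_def
  using R_nth_Suc has_sum_imp_summable[OF trace_has_sum]
  by (auto simp: summable_on_def star_power_L simp del: star_power.simps)

text \<open>Jacobi's formula with \<open>M' = - (x P)' C\<close> and \<open>C N = W\<close>.\<close>

lemma fps_deriv_det_M:
  "fps_deriv (det M) = - det M * (\<Sum>a\<in>UNIV. \<Sum>b\<in>UNIV. W a b * fps_deriv (fps_X * A a b))"
proof -
  have "fps_deriv (M $ a $ b) = - (fps_deriv (fps_X * A b a) * fps_const (c b))" for a b
    by (simp add: M_def)
  then have "trace ((\<chi> i j. fps_deriv (M $ i $ j)) ** N) =
      (\<Sum>a\<in>UNIV. \<Sum>b\<in>UNIV. - (W b a * fps_deriv (fps_X * A b a)))"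
    unfolding trace_def matrix_matrix_mult_def by (simp add: W_def mult_ac del: fps_deriv_mult)
  also have "\<dots> = - (\<Sum>a\<in>UNIV. \<Sum>b\<in>UNIV. W a b * fps_deriv (fps_X * A a b))"
    by (subst sum.swap) (simp only: sum_negf)
  finally show ?thesis
    by (simp add: fps_deriv_det_left_inverse[OF N_M] mult.commute del: fps_deriv_mult)
qed

lemma fps_deriv_tr_ln_L:
  "fps_deriv (tr_ln L) = - Abs_fps (\<lambda>n. \<Sum>\<^sub>\<infinity>i. v i ^ Suc n) -
    (\<Sum>a\<in>UNIV. \<Sum>b\<in>UNIV. W a b * fps_deriv (fps_X * A a b))"
  by (rule fps_ext)
    (simp add: fps_deriv_tr_ln_nth tr_def infsumI[OF trace_has_sum]
      del: star_power.simps fps_deriv_mult fps_deriv_nth)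

end

text \<open>For \<open>c = 0\<close> the matrix \<open>W\<close> vanishes, so the results on
  \<open>L\<close> specialize to \<open>V\<close>.\<close>

lemma finite_rank_perturbation_0:
  assumes "finite_rank_perturbation v \<xi> \<eta>"
  shows "finite_rank_perturbation.L v \<xi> \<eta> (\<lambda>_. 0) = V_modes v"
    and "fps_deriv (tr_ln (V_modes v)) = - Abs_fps (\<lambda>n. \<Sum>\<^sub>\<infinity>i. v i ^ Suc n)"
proof -
  interpret finite_rank_perturbation v \<xi> \<eta> "\<lambda>_. 0" by fact
  show *: "L = V_modes v" by (simp add: L_def fun_eq_iff)
  have "W a b = 0" for a b by (simp add: W_def)
  then show "fps_deriv (tr_ln (V_modes v)) = - Abs_fps (\<lambda>n. \<Sum>\<^sub>\<infinity>i. v i ^ Suc n)"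
    using fps_deriv_tr_ln_L by (simp add: *)
qed

context finite_rank_perturbation begin

text \<open>Both sides have constant term 1 and solve \<open>Y' = Y * fps_deriv (tr_ln L)\<close>;
  on the left the product rule adds the logarithmic derivative of \<open>det M\<close> to that of
  the exponential.\<close>

lemma exp_tr_ln_L: "exp_fps (tr_ln (V_modes v)) * det M = exp_fps (tr_ln L)"
proof (rule fps_ode_unique)
  have tr_ln_nth_0: "fps_nth (tr_ln F) 0 = 0" for F by (simp add: tr_ln_def)
  show "fps_deriv (exp_fps (tr_ln L)) = exp_fps (tr_ln L) * fps_deriv (tr_ln L)"
    by (simp add: fps_deriv_exp_fps tr_ln_nth_0)
  show "fps_deriv (exp_fps (tr_ln (V_modes v)) * det M) =
    exp_fps (tr_ln (V_modes v)) * det M * fps_deriv (tr_ln L)"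
    unfolding fps_deriv_tr_ln_L fps_deriv_mult[of "exp_fps _"] fps_deriv_det_M
      fps_deriv_exp_fps[OF tr_ln_nth_0]
      finite_rank_perturbation_0(2)[OF finite_rank_perturbation_axioms]
    by (simp add: algebra_simps del: fps_deriv_mult)
  show "fps_nth (exp_fps (tr_ln (V_modes v)) * det M) 0 = fps_nth (exp_fps (tr_ln L)) 0"
    by (simp add: exp_fps_nth_0 det_M_nth_0)
qed

end

section \<open>The determinant of \<open>z - T\<close>\<close>

lemma det_mat_minus_diag: "det (mat z - diag zs) = (\<Prod>a\<in>UNIV. z - zs a)"
  for z :: "'a::comm_ring_1"
  by (subst det_diagonal) (auto simp: diag_def mat_def)

text \<open>Off the poles \<open>(z - zs a) * c a = zs a\<close>, so \<open>z - T\<close> factors as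
  \<open>z - Z\<close> times the transpose of \<open>M\<close>.\<close>

lemma det_z_minus_T_matrix:
  fixes zs :: "'m::finite \<Rightarrow> complex"
  assumes "finite_rank_perturbation v \<xi> \<eta>" and z: "z \<notin> range zs"
  shows "det (mat (fps_const z) - T_matrix zs v \<xi> \<eta>) =
    fps_const (det (mat z - diag zs)) *
    det (finite_rank_perturbation.M v \<xi> \<eta> (\<lambda>k. zs k / (z - zs k)))"
proof -
  interpret finite_rank_perturbation v \<xi> \<eta> "\<lambda>k. zs k / (z - zs k)" by fact
  have diag_mult: "(diag d ** X) $ a $ b = d a * X $ a $ b"
    for d :: "'m \<Rightarrow> complex fps" and X :: "complex fps^'m^'m" and a b
    by (simp add: matrix_matrix_mult_def diag_def if_distrib if_distribR cong: if_cong)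
  have shift: "Abs_fps (\<lambda>k. if k = 0 then 0 else A_entry v \<xi> \<eta> (k - 1) a b) = fps_X * A a b" for a b
    by (rule fps_ext) (simp add: A_def)
  have "mat (fps_const z) - T_matrix zs v \<xi> \<eta> = diag (\<lambda>a. fps_const (z - zs a)) ** transpose M"
  proof -
    have "fps_const (z - zs a) * (f * fps_const (zs a / (z - zs a))) = fps_const (zs a) * f"
      for a and f :: "complex fps"
    proof -
      have "z - zs a \<noteq> 0" using z by auto
      then have "fps_const (z - zs a) * fps_const (zs a / (z - zs a)) = fps_const (zs a)"
        by simp
      then show ?thesis by (metis mult.commute mult.left_commute)
    qed
    then have "fps_const (z - zs a) * (d - fps_X * A a b * fps_const (zs a / (z - zs a))) =
        fps_const (z - zs a) * d - fps_const (zs a) * (fps_X * A a b)" for a b d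
      by (simp only: right_diff_distrib)
    then show ?thesis
      by (simp add: vec_eq_iff T_matrix_def diag_mult shift M_def transpose_def mat_def distrib_left
          del: fps_const_mult)
  qed
  moreover have "det (diag (\<lambda>a. fps_const (z - zs a)) :: complex fps^'m^'m) =
      (\<Prod>a\<in>UNIV. fps_const (z - zs a))"
    by (subst det_diagonal) (auto simp: diag_def)
  moreover have "(\<Prod>a\<in>S. fps_const (f a)) = fps_const (\<Prod>a\<in>S. f a)" for S and f :: "'m \<Rightarrow> complex"
    by (induction S rule: infinite_finite_induct) auto
  ultimately show ?thesis by (simp add: det_mul det_mat_minus_diag)
qed

subsection \<open>Rationality in the spectral parameter\<close>

lemma rational_coeffs_off_const: "rational_coeffs_off S (\<lambda>_. f)"
  unfolding rational_coeffs_off_def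
proof
  fix n
  show "\<exists>p q. \<forall>z. z \<notin> S \<longrightarrow> poly q z \<noteq> 0 \<and> fps_nth f n = poly p z / poly q z"
    by (rule exI[of _ "[:fps_nth f n:]"], rule exI[of _ 1]) simp
qed

lemma rational_coeffs_off_fps_const:
  assumes "\<And>z. z \<notin> S \<Longrightarrow> poly q z \<noteq> 0 \<and> h z = poly p z / poly q z"
  shows "rational_coeffs_off S (\<lambda>z. fps_const (h z))"
  unfolding rational_coeffs_off_def
proof
  fix n
  show "\<exists>p q. \<forall>z. z \<notin> S \<longrightarrow> poly q z \<noteq> 0 \<and> fps_nth (fps_const (h z)) n = poly p z / poly q z"
    by (rule exI[of _ "if n = 0 then p else 0"], rule exI[of _ q]) (simp add: assms)
qed

lemma rational_function_sum:
  fixes h :: "'i \<Rightarrow> complex \<Rightarrow> complex"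
  assumes "finite I"
    and "\<And>i. i \<in> I \<Longrightarrow> \<exists>p q. \<forall>z. z \<notin> S \<longrightarrow> poly q z \<noteq> 0 \<and> h i z = poly p z / poly q z"
  shows "\<exists>p q. \<forall>z. z \<notin> S \<longrightarrow> poly q z \<noteq> 0 \<and> (\<Sum>i\<in>I. h i z) = poly p z / poly q z"
  using assms
proof (induction I)
  case empty
  show ?case by (rule exI[of _ 0], rule exI[of _ 1]) simp
next
  case (insert i I)
  then obtain p q p' q' where
    "\<forall>z. z \<notin> S \<longrightarrow> poly q z \<noteq> 0 \<and> h i z = poly p z / poly q z"
    "\<forall>z. z \<notin> S \<longrightarrow> poly q' z \<noteq> 0 \<and> (\<Sum>i\<in>I. h i z) = poly p' z / poly q' z"
    by (metis insertCI)
  with insert show ?case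
    \<comment> \<open>The common denominator remains nonzero outside \<open>S\<close>.\<close>
    by (intro exI[of _ "p * q' + p' * q"] exI[of _ "q * q'"]) (simp add: add_frac_eq)
qed

lemma rational_coeffs_off_sum:
  assumes "finite I" and "\<And>i. i \<in> I \<Longrightarrow> rational_coeffs_off S (f i)"
  shows "rational_coeffs_off S (\<lambda>z. \<Sum>i\<in>I. f i z)"
  using assms unfolding rational_coeffs_off_def fps_sum_nth
  by (intro allI rational_function_sum) auto

lemma rational_coeffs_off_add:
  assumes "rational_coeffs_off S f" and "rational_coeffs_off S g"
  shows "rational_coeffs_off S (\<lambda>z. f z + g z)"
  using rational_coeffs_off_sum[of UNIV S "\<lambda>b. if b then f else g"] assms
  by (simp add: UNIV_bool add.commute)

lemma rational_coeffs_off_mult: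
  assumes "rational_coeffs_off S f" and "rational_coeffs_off S g"
  shows "rational_coeffs_off S (\<lambda>z. f z * g z)"
  unfolding rational_coeffs_off_def fps_mult_nth
proof (intro allI rational_function_sum)
  fix n i
  obtain p q p' q' where
    "\<forall>z. z \<notin> S \<longrightarrow> poly q z \<noteq> 0 \<and> fps_nth (f z) i = poly p z / poly q z"
    "\<forall>z. z \<notin> S \<longrightarrow> poly q' z \<noteq> 0 \<and> fps_nth (g z) (n - i) = poly p' z / poly q' z"
    using assms unfolding rational_coeffs_off_def by metis
  then show "\<exists>p q. \<forall>z. z \<notin> S \<longrightarrow>
      poly q z \<noteq> 0 \<and> fps_nth (f z) i * fps_nth (g z) (n - i) = poly p z / poly q z"
    by (intro exI[of _ "p * p'"] exI[of _ "q * q'"]) simp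
qed simp

lemma rational_coeffs_off_prod:
  assumes "finite I" and "\<And>i. i \<in> I \<Longrightarrow> rational_coeffs_off S (f i)"
  shows "rational_coeffs_off S (\<lambda>z. \<Prod>i\<in>I. f i z)"
  using assms
  by (induction I) (auto intro: rational_coeffs_off_const rational_coeffs_off_mult)

lemma rational_coeffs_off_det:
  assumes "\<And>i j. rational_coeffs_off S (\<lambda>z. f z $ i $ j)"
  shows "rational_coeffs_off S (\<lambda>z. det (f z))"
  unfolding det_def
  by (intro rational_coeffs_off_sum rational_coeffs_off_mult rational_coeffs_off_prod
      rational_coeffs_off_const assms) auto

lemma rational_coeffs_off_cong:
  assumes "rational_coeffs_off S f" and "\<And>z. z \<notin> S \<Longrightarrow> f z = g z"
  shows "rational_coeffs_off S g"
  using assms unfolding rational_coeffs_off_def by metis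

lemma rational_coeffs_off_z_minus:
  fixes T :: "complex fps^'m^'m"
  shows "rational_coeffs_off S (\<lambda>z. det (mat (fps_const z) - T))"
proof (rule rational_coeffs_off_det)
  fix i j :: 'm
  have "rational_coeffs_off S (\<lambda>z. fps_const (if i = j then z else 0))"
    by (rule rational_coeffs_off_fps_const[of _ 1 _ "if i = j then [:0, 1:] else 0"]) simp
  then have "rational_coeffs_off S (\<lambda>z. fps_const (if i = j then z else 0) + - T $ i $ j)"
    by (intro rational_coeffs_off_add rational_coeffs_off_const)
  then show "rational_coeffs_off S (\<lambda>z. (mat (fps_const z) - T) $ i $ j)"
    by (rule rational_coeffs_off_cong) (simp add: mat_def)
qed

subsection \<open>Convergence\<close>

lemma inverse_square_summable_on_int:
  "(\<lambda>k::int. 1 / (1 + (real_of_int k)\<^sup>2)) summable_on UNIV"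
proof -
  have "summable (\<lambda>n. inverse (real n ^ 2))"
    using inverse_power_summable[of 2, where 'a = real] by simp
  then have sum: "summable (\<lambda>n. 1 / (1 + (real n)\<^sup>2))"
  proof (rule summable_comparison_test_ev[rotated])
    \<comment> \<open>At \<open>n = 0\<close> the bound is \<open>inverse 0 = 0\<close>, so the
      comparison holds only eventually.\<close>
    show "\<forall>\<^sub>F n in sequentially. norm (1 / (1 + (real n)\<^sup>2)) \<le> inverse (real n ^ 2)"
      using eventually_gt_at_top[of 0]
      by eventually_elim (simp add: field_simps add_pos_nonneg)
  qed
  have nonneg: "(\<lambda>n. 1 / (1 + (real n)\<^sup>2)) summable_on UNIV"
    by (rule norm_summable_imp_summable_on) (use sum in simp)
  have neg: "(\<lambda>n. 1 / (1 + (real (Suc n))\<^sup>2)) summable_on UNIV"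
    by (rule norm_summable_imp_summable_on)
      (use sum[THEN summable_Suc_iff[THEN iffD2]] in \<open>simp del: of_nat_Suc\<close>)
  have "(\<lambda>k::int. 1 / (1 + (real_of_int k)\<^sup>2)) summable_on range int"
    using nonneg by (subst summable_on_reindex) (auto simp: o_def)
  moreover have "(\<lambda>k::int. 1 / (1 + (real_of_int k)\<^sup>2)) summable_on range (\<lambda>n. - int (Suc n))"
  proof (subst summable_on_reindex)
    have "(- 1 - real n)\<^sup>2 = (1 + real n)\<^sup>2" for n by (simp add: power2_eq_square algebra_simps)
    then show "((\<lambda>k::int. 1 / (1 + (real_of_int k)\<^sup>2)) \<circ> (\<lambda>n. - int (Suc n))) summable_on UNIV"
      using neg by (simp add: o_def)
  qed (simp add: inj_on_def)
  moreover have "range int \<inter> range (\<lambda>n. - int (Suc n)) = {}" by auto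
  ultimately have "(\<lambda>k::int. 1 / (1 + (real_of_int k)\<^sup>2)) summable_on
      (range int \<union> range (\<lambda>n. - int (Suc n)))"
    by (rule summable_on_Un_disjoint)
  moreover have "k \<in> range int \<union> range (\<lambda>n. - int (Suc n))" for k :: int
    by (cases k rule: int_cases) auto
  then have "range int \<union> range (\<lambda>n. - int (Suc n)) = UNIV" by blast
  ultimately show ?thesis by simp
qed

text \<open>The set where the bound fails is finite, and on its complement comparison
  applies.\<close>

lemma summable_on_int_eventually:
  fixes f :: "int \<Rightarrow> complex"
  assumes "\<forall>\<^sub>F k in cofinite. norm (f k) \<le> 1 / (1 + (real_of_int k)\<^sup>2)"
  shows "f summable_on UNIV"
proof -
  let ?B = "{k. \<not> norm (f k) \<le> 1 / (1 + (real_of_int k)\<^sup>2)}"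
  have "f summable_on - ?B"
  proof (rule abs_summable_summable, rule Infinite_Sum.abs_summable_on_comparison_test')
    show "(\<lambda>k::int. 1 / (1 + (real_of_int k)\<^sup>2)) summable_on - ?B"
      by (rule summable_on_subset_banach[OF inverse_square_summable_on_int]) simp
  qed auto
  moreover have "f summable_on ?B"
    using assms by (simp add: eventually_cofinite)
  ultimately have "f summable_on (?B \<union> - ?B)"
    by (intro summable_on_Un_disjoint) auto
  then show ?thesis by (simp add: Compl_partition)
qed

lemma rapidly_decaying_eventually:
  assumes "rapidly_decaying v"
  shows "\<forall>\<^sub>F k in cofinite. norm (v k) \<le> 1 / (1 + (real_of_int k)\<^sup>2)"
proof -
  \<comment> \<open>With exponent 2 the expression is the square of
    \<open>cmod (v k) * (1 + k\<^sup>2)\<close>, so a square root gives the desired bound.\<close>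
  have "((\<lambda>k. (cmod (v k))\<^sup>2 * (1 + (real_of_int k)\<^sup>2) ^ 2) \<longlongrightarrow> 0) cofinite"
    using assms unfolding rapidly_decaying_def by blast
  then have "\<forall>\<^sub>F k in cofinite. (cmod (v k))\<^sup>2 * (1 + (real_of_int k)\<^sup>2) ^ 2 < 1"
    by (rule order_tendstoD) simp
  then show ?thesis
  proof eventually_elim
    case (elim k)
    have "(cmod (v k) * (1 + (real_of_int k)\<^sup>2)) ^ 2 \<le> 1 ^ 2"
      using elim by (simp add: power_mult_distrib)
    then have "cmod (v k) * (1 + (real_of_int k)\<^sup>2) \<le> 1"
      by (rule power2_le_imp_le) simp
    then show ?case by (simp add: pos_le_divide_eq add_pos_nonneg)
  qed
qed

lemma finite_rank_perturbation_rapidly_decaying: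
  assumes "inj v" and "rapidly_decaying v"
    and "\<And>a. ((\<lambda>i. cmod (\<xi> a i) / (cmod (v i))\<^sup>2) \<longlongrightarrow> 0) cofinite"
    and "\<And>a. ((\<lambda>i. cmod (\<eta> a i) / (cmod (v i))\<^sup>2) \<longlongrightarrow> 0) cofinite"
  shows "finite_rank_perturbation v \<xi> \<eta>"
proof
  note decay = rapidly_decaying_eventually[OF \<open>rapidly_decaying v\<close>]
  have le1: "1 / (1 + (real_of_int k)\<^sup>2) \<le> 1" for k by (simp add: add_pos_nonneg)
  show "(\<lambda>i. v i ^ Suc n) summable_on UNIV" for n
  proof (rule summable_on_int_eventually, use decay in eventually_elim)
    case (elim k)
    have "norm (v k) ^ n \<le> 1"
      using elim le1[of k] by (intro power_le_one) auto
    then have "norm (v k) * norm (v k) ^ n \<le> norm (v k)"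
      by (intro mult_left_le) auto
    then show ?case using elim by (simp add: norm_mult norm_power)
  qed
  \<comment> \<open>Injectivity leaves at most one zero of \<open>v\<close>. At a zero the quotients
    in the hypotheses are 0 by convention and say nothing about their numerators.\<close>
  have "finite (v -` {0})" by (rule finite_vimageI[OF _ \<open>inj v\<close>]) simp
  then have nz: "\<forall>\<^sub>F i in cofinite. v i \<noteq> 0"
    by (simp add: eventually_cofinite vimage_def)
  have dom: "\<forall>\<^sub>F i in cofinite. cmod (x i) \<le> (cmod (v i))\<^sup>2"
    if "((\<lambda>i. cmod (x i) / (cmod (v i))\<^sup>2) \<longlongrightarrow> 0) cofinite" for x
  proof -
    have "\<forall>\<^sub>F i in cofinite. cmod (x i) / (cmod (v i))\<^sup>2 < 1"
      using that by (rule order_tendstoD) simp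
    then show ?thesis
      using nz by eventually_elim (simp add: divide_less_eq)
  qed
  show "(\<lambda>i. v i ^ k * \<xi> a i * \<eta> b i) summable_on UNIV" for k a b
  proof (rule summable_on_int_eventually,
      use decay dom[OF assms(3)[of a]] dom[OF assms(4)[of b]] in eventually_elim)
    case (elim i)
    have v1: "norm (v i) \<le> 1" using elim(1) le1[of i] by linarith
    \<comment> \<open>The decay comes from \<open>\<eta>\<close> alone, the other factors being at
      most 1; this also covers \<open>k = 0\<close>.\<close>
    have "norm (v i ^ k * \<xi> a i * \<eta> b i) \<le> 1 * 1 * (norm (v i))\<^sup>2"
      unfolding norm_mult norm_power
    proof (intro mult_mono)
      show "norm (\<xi> a i) \<le> 1"
        using elim(2) power_le_one[OF norm_ge_zero v1, of 2] by linarith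
    qed (use elim v1 in \<open>auto intro: power_le_one\<close>)
    also have "\<dots> \<le> norm (v i)"
      using mult_left_le[OF v1] by (simp add: power2_eq_square)
    finally show ?case using elim(1) by simp
  qed
qed

theorem theorem2:
  fixes zs :: "'m::finite \<Rightarrow> complex"
    and v :: "int \<Rightarrow> complex"
    and \<xi> \<eta> :: "'m \<Rightarrow> int \<Rightarrow> complex"
  assumes "inj v"
    and "rapidly_decaying v"
    and "\<And>a. ((\<lambda>i. cmod (\<xi> a i) / (cmod (v i))\<^sup>2) \<longlongrightarrow> 0) cofinite"
    and "\<And>a. ((\<lambda>i. cmod (\<eta> a i) / (cmod (v i))\<^sup>2) \<longlongrightarrow> 0) cofinite"
  shows "tr_ln_defined (V_modes v) \<and>
     (\<forall>k a b. (\<lambda>i. v i ^ k * \<xi> a i * \<eta> b i) summable_on UNIV) \<and>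
     (\<forall>z. z \<notin> range zs \<longrightarrow> tr_ln_defined (Lax zs v \<xi> \<eta> z)) \<and>
     rational_coeffs_off (range zs) (\<lambda>z. det (mat (fps_const z) - T_matrix zs v \<xi> \<eta>)) \<and>
     rational_coeffs_off (range zs) (\<lambda>z. exp_fps (tr_ln (Lax zs v \<xi> \<eta> z))) \<and>
     (\<forall>z. z \<notin> range zs \<longrightarrow>
           exp_fps (tr_ln (V_modes v)) * det (mat (fps_const z) - T_matrix zs v \<xi> \<eta>) =
           fps_const (det (mat z - diag zs)) * exp_fps (tr_ln (Lax zs v \<xi> \<eta> z)))"
proof -
  have frp: "finite_rank_perturbation v \<xi> \<eta>"
    by (rule finite_rank_perturbation_rapidly_decaying) (fact assms)+
  have Lax: "finite_rank_perturbation.L v \<xi> \<eta> (\<lambda>k. zs k / (z - zs k)) = Lax zs v \<xi> \<eta> z" for z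
    by (simp add: finite_rank_perturbation.L_def[OF frp] Lax_def fun_eq_iff)
  have identity: "exp_fps (tr_ln (V_modes v)) * det (mat (fps_const z) - T_matrix zs v \<xi> \<eta>) =
      fps_const (det (mat z - diag zs)) * exp_fps (tr_ln (Lax zs v \<xi> \<eta> z))" if "z \<notin> range zs" for z
    unfolding det_z_minus_T_matrix[OF frp that] Lax[symmetric]
      finite_rank_perturbation.exp_tr_ln_L[OF frp, symmetric]
    by (simp add: mult_ac)
  \<comment> \<open>Rationality of the side with \<open>Lax\<close>, which is built from infinite
    sums, is read off from the identity divided by \<open>det (z - Z)\<close>, a polynomial without
    zeros off \<open>range zs\<close>.\<close>
  have "rational_coeffs_off (range zs) (\<lambda>z. fps_const (1 / det (mat z - diag zs)) *
      (exp_fps (tr_ln (V_modes v)) * det (mat (fps_const z) - T_matrix zs v \<xi> \<eta>)))"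
  proof (intro rational_coeffs_off_mult rational_coeffs_off_const rational_coeffs_off_z_minus)
    show "rational_coeffs_off (range zs) (\<lambda>z. fps_const (1 / det (mat z - diag zs)))"
      by (rule rational_coeffs_off_fps_const[of _ "\<Prod>a\<in>UNIV. [:- zs a, 1:]" _ 1])
        (auto simp: det_mat_minus_diag poly_prod)
  qed
  then have rational: "rational_coeffs_off (range zs) (\<lambda>z. exp_fps (tr_ln (Lax zs v \<xi> \<eta> z)))"
  proof (rule rational_coeffs_off_cong)
    fix z assume z: "z \<notin> range zs"
    then have "det (mat z - diag zs) \<noteq> 0" by (auto simp: det_mat_minus_diag)
    then show "fps_const (1 / det (mat z - diag zs)) *
        (exp_fps (tr_ln (V_modes v)) * det (mat (fps_const z) - T_matrix zs v \<xi> \<eta>)) =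
        exp_fps (tr_ln (Lax zs v \<xi> \<eta> z))"
      unfolding identity[OF z] by (simp flip: mult.assoc)
  qed
  \<comment> \<open>The instance \<open>c = 0\<close> supplies convergence for
    \<open>V\<close>.\<close>
  show ?thesis
    using identity rational rational_coeffs_off_z_minus
      finite_rank_perturbation.summable_moments[OF frp]
      finite_rank_perturbation.tr_ln_defined_L[OF frp, of "\<lambda>_. 0"]
      finite_rank_perturbation.tr_ln_defined_L[OF frp]
    by (simp add: finite_rank_perturbation_0(1)[OF frp] flip: Lax)
qed

end
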